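(* Consider two arbitrary matrices $\bar{\boldsymbol{\Phi}}, \boldsymbol{\Phi} \in \mathbb{R}^{s\times r}$ with $\Delta_{\boldsymbol{\Phi}} := \|\bar{\boldsymbol{\Phi}} - \boldsymbol{\Phi}\|_F$. Suppose there exists a partition $\Omega_{1:r}$ on $[s]$ such that for any $i,i' \in \Omega_k$, $\bar{\boldsymbol{\Phi}}(i,:) = \bar{\boldsymbol{\Phi}}(i',:)$. Assume $\operatorname{rank}(\bar{\boldsymbol{\Phi}}) = r$. Let $\mathbf{U} \in \mathbb{R}^{s\times r}$ denote the top-$r$ left singular vectors of $\boldsymbol{\Phi}$ with $\mathbf{U}^\top \mathbf{U} = \mathbf{I}_{r}$. Let $\{\hat{\Omega}_{1:r}, \hat{c}_{1:r}\}$ be a $(1+\epsilon)$ solution to the k-means problem on clustering the rows of $\mathbf{U}$. Then, when $\Delta_{\boldsymbol{\Phi}} \leq \frac{\sigma_r(\bar{\boldsymbol{\Phi}}) \sqrt{|\Omega_{(r)}| + |\Omega_{(1)}|}}{8 \sqrt{(2+\epsilon) |\Omega_{(1)}|}}$, we have $\textup{MR}(\hat{\Omega}_{1:r}) \leq \frac{64(2+\epsilon)}{\sigma_{r}(\bar{\boldsymbol{\Phi}})^2} \Delta_{\boldsymbol{\Phi}}^2$.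
   Context: A $(1+\epsilon)$ k-means solution is a partition with centers whose k-means objective $\sum_k\sum_{i\in\hat{\Omega}_k}\|\mathbf{U}(i,:)-\hat{c}_k\|^2$ is at most $(1+\epsilon)$ times the optimal value. The misclustering rate is $\textup{MR}(\hat{\Omega}_{1:r})=\min_h\sum_{k\in[r]}|\{i:i\in\Omega_k,i\notin\hat{\Omega}_{h(k)}\}|/|\Omega_k|$, minimized over bijections $h:[r]\to[r]$; $\Omega_{(i)}$ denotes the cluster of $i$-th largest cardinality; $\sigma_r(\cdot)$ is the $r$-th largest singular value. *)

theory Defs
  imports "HOL-Analysis.Analysis"
begin

text \<open>Matrices in R^(s x r) are modelled as real^'r^'s (rows indexed by the finite
type 's, columns by the finite type 'r); so s = CARD('s), r = CARD('r).
The i-th row of A is A $ i.\<close>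

definition frob_norm :: "real^'r^'s \<Rightarrow> real" where
  "frob_norm A = sqrt (\<Sum>i\<in>UNIV. \<Sum>j\<in>UNIV. (A $ i $ j)^2)"

text \<open>Eigenvalues of a square real matrix.\<close>
definition eigenvalues :: "real^'n^'n \<Rightarrow> real set" where
  "eigenvalues M = {mu. \<exists>x. x \<noteq> 0 \<and> M *v x = mu *s x}"

text \<open>sigma_r(A) for A in R^(s x r), s \<ge> r: the r-th largest (i.e. smallest) singular
value, the square root of the smallest eigenvalue of A^T A.\<close>
definition sigma_r :: "real^'r^'s \<Rightarrow> real" where
  "sigma_r A = sqrt (Min (eigenvalues (transpose A ** A)))"

text \<open>A partition of the row index set into r (nonempty) blocks indexed by 'r.\<close>
definition is_partition :: "('r \<Rightarrow> 's set) \<Rightarrow> bool" where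
  "is_partition \<Omega> \<longleftrightarrow> (\<forall>k. \<Omega> k \<noteq> {}) \<and> (\<forall>k k'. k \<noteq> k' \<longrightarrow> \<Omega> k \<inter> \<Omega> k' = {})
      \<and> (\<Union>k. \<Omega> k) = UNIV"

text \<open>U consists of top-r left singular vectors of Phi (thin SVD Phi = U Sigma V^T).\<close>
definition top_left_singular_vectors :: "real^'r^'s \<Rightarrow> real^'r^'s \<Rightarrow> bool" where
  "top_left_singular_vectors U \<Phi> \<longleftrightarrow> transpose U ** U = mat 1 \<and>
     (\<exists>(S::real^'r^'r) (V::real^'r^'r). (\<forall>i j. i \<noteq> j \<longrightarrow> S $ i $ j = 0) \<and> (\<forall>i. S $ i $ i \<ge> 0)
        \<and> orthogonal_matrix V \<and> \<Phi> = U ** S ** transpose V)"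

definition kmeans_obj :: "real^'r^'s \<Rightarrow> ('r \<Rightarrow> 's set) \<Rightarrow> ('r \<Rightarrow> real^'r) \<Rightarrow> real" where
  "kmeans_obj U \<Omega> c = (\<Sum>k\<in>UNIV. \<Sum>i\<in>\<Omega> k. (norm (U $ i - c k))^2)"

definition kmeans_opt :: "real^'r^'s \<Rightarrow> real" where
  "kmeans_opt U = Inf {kmeans_obj U \<Omega> c | \<Omega> c. is_partition \<Omega>}"

definition approx_kmeans_solution ::
  "real \<Rightarrow> real^'r^'s \<Rightarrow> ('r \<Rightarrow> 's set) \<Rightarrow> ('r \<Rightarrow> real^'r) \<Rightarrow> bool" where
  "approx_kmeans_solution \<epsilon> U \<Omega> c \<longleftrightarrow> is_partition \<Omega> \<and> kmeans_obj U \<Omega> c \<le> (1 + \<epsilon>) * kmeans_opt U"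

definition misclustering_rate :: "('r::finite \<Rightarrow> 's set) \<Rightarrow> ('r \<Rightarrow> 's set) \<Rightarrow> real" where
  "misclustering_rate \<Omega> \<Omega>h = Min {(\<Sum>k\<in>UNIV. real (card {i. i \<in> \<Omega> k \<and> i \<notin> \<Omega>h (h k)}) / real (card (\<Omega> k)))
      | h. bij h}"

definition max_cluster_size :: "('r \<Rightarrow> 's set) \<Rightarrow> nat" where
  "max_cluster_size \<Omega> = Max (range (\<lambda>k. card (\<Omega> k)))"

definition min_cluster_size :: "('r \<Rightarrow> 's set) \<Rightarrow> nat" where
  "min_cluster_size \<Omega> = Min (range (\<lambda>k. card (\<Omega> k)))"

end

(*
  Write Delta = ||Phibar - Phi||_F and sigma = sigma_r(Phibar). Because U spans the column space
  of Phi, the r x r matrix C = U^T Phibar satisfies U C = Phibar - (I - U U^T)(Phibar - Phi), so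
  |C x| >= (sigma - Delta) |x|. Hence C is invertible, and M = Phibar C^-1 has rows that are
  constant on the true clusters, satisfies U^T M = I, and is close to U:
  ||U - M||_F <= Delta / (sigma - Delta).

  The identity U^T M = I forces the distinct rows m_k of M apart,
  |m_k - m_l|^2 >= 1/n_k + 1/n_l, by testing against normalised cluster indicators. Since M
  itself is a feasible k-means configuration, the centres of a (1+eps)-approximate solution lie
  within total squared distance 2(2+eps) ||U - M||_F^2 of the rows of M. A Markov-type count in
  the style of Lei and Rinaldo then shows that in every cluster only few points are assigned to
  a centre far from their own m_k, and the remaining points determine a matching of true and
  estimated clusters that misclassifies at most those few points.
*)

theory Submission
  imports Defs
begin

section \<open>Frobenius norm and orthonormal columns\<close>

lemma power2_norm_vec: "(norm (x :: real^'n))\<^sup>2 = (\<Sum>j\<in>UNIV. (x $ j)\<^sup>2)"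
  unfolding power2_norm_eq_inner by (simp add: inner_vec_def power2_eq_square)

lemma frob_norm_nonneg: "0 \<le> frob_norm A"
  unfolding frob_norm_def by (simp add: sum_nonneg)

lemma frob_norm_uminus [simp]: "frob_norm (- A) = frob_norm A"
  unfolding frob_norm_def by simp

lemma frob_norm_sq_rows: "(frob_norm A)\<^sup>2 = (\<Sum>i\<in>UNIV. (norm (A $ i))\<^sup>2)"
  unfolding frob_norm_def power2_norm_vec by (simp add: sum_nonneg)

lemma frob_norm_sq_columns: "(frob_norm A)\<^sup>2 = (\<Sum>j\<in>UNIV. (norm (column j A))\<^sup>2)"
  unfolding frob_norm_def power2_norm_vec column_def
  by (subst sum.swap) (simp add: sum_nonneg)

lemma inner_matrix_vector_transpose: "inner (A *v x) y = inner x (transpose A *v (y :: real^'m))"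
  for A :: "real^'n^'m"
  by (metis dot_lmul_matrix inner_commute transpose_matrix_vector)

lemma row_matrix_matrix_mult: "(A ** B) $ i = A $ i v* B"
  by (simp add: matrix_matrix_mult_def vector_matrix_mult_def vec_eq_iff)

lemma matrix_diff_rdistrib: "(A - B) ** C = A ** C - B ** C"
  for A B :: "real^'n^'m" and C :: "real^'p^'n"
  by (simp add: matrix_matrix_mult_def vec_eq_iff sum_subtractf algebra_simps)

lemma norm_matrix_vector_le_frob_norm: "norm (A *v x) \<le> frob_norm A * norm x"
proof (rule power2_le_imp_le)
  have "(norm (A *v x))\<^sup>2 = (\<Sum>i\<in>UNIV. (inner (A $ i) x)\<^sup>2)"
    by (simp add: power2_norm_vec matrix_vector_mul_component)
  also have "\<dots> \<le> (\<Sum>i\<in>UNIV. (norm (A $ i))\<^sup>2 * (norm x)\<^sup>2)"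
    by (intro sum_mono) (simp add: Cauchy_Schwarz_ineq power2_norm_eq_inner)
  also have "\<dots> = (frob_norm A * norm x)\<^sup>2"
    by (simp add: frob_norm_sq_rows power_mult_distrib sum_distrib_right)
  finally show "(norm (A *v x))\<^sup>2 \<le> (frob_norm A * norm x)\<^sup>2" .
qed (simp add: frob_norm_nonneg)

lemma norm_vector_matrix_mult_le:
  fixes D :: "real^'n^'m"
  assumes bound: "\<And>z. norm (D *v z) \<le> L * norm z" and "0 \<le> L"
  shows "norm (x v* D) \<le> L * norm x"
proof -
  let ?w = "x v* D"
  have "(norm ?w)\<^sup>2 = inner x (D *v ?w)"
    by (simp add: power2_norm_eq_inner dot_lmul_matrix)
  also have "\<dots> \<le> norm x * norm (D *v ?w)"
    by (rule Cauchy_Schwarz_ineq2[THEN abs_le_D1])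
  also have "\<dots> \<le> L * norm x * norm ?w"
    using mult_left_mono[OF bound[of ?w] norm_ge_zero[of x]] by (simp add: ac_simps)
  finally have "norm ?w * norm ?w \<le> (L * norm x) * norm ?w"
    by (simp add: power2_eq_square)
  then show ?thesis
    using \<open>0 \<le> L\<close> by (cases "norm ?w = 0") simp_all
qed

lemma frob_norm_matrix_mult_le:
  fixes D :: "real^'n^'m"
  assumes "\<And>z. norm (D *v z) \<le> L * norm z" and "0 \<le> L"
  shows "frob_norm (A ** D) \<le> L * frob_norm A"
proof (rule power2_le_imp_le)
  have "norm ((A ** D) $ i) \<le> L * norm (A $ i)" for i
    unfolding row_matrix_matrix_mult by (rule norm_vector_matrix_mult_le[OF assms])
  then have "(norm ((A ** D) $ i))\<^sup>2 \<le> L\<^sup>2 * (norm (A $ i))\<^sup>2" for i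
    by (metis norm_ge_zero power_mono power_mult_distrib)
  then show "(frob_norm (A ** D))\<^sup>2 \<le> (L * frob_norm A)\<^sup>2"
    unfolding frob_norm_sq_rows power_mult_distrib sum_distrib_left by (rule sum_mono)
qed (simp add: frob_norm_nonneg assms(2))

lemma exists_right_inverse_norm_le:
  fixes C :: "real^'n^'n"
  assumes "0 < \<kappa>" and lower: "\<And>x. \<kappa> * norm x \<le> norm (C *v x)"
  obtains D where "C ** D = mat 1" and "\<And>z. norm (D *v z) \<le> norm z / \<kappa>"
proof -
  have "inj ((*v) C)"
  proof (rule injI)
    fix x y
    assume "C *v x = C *v y"
    then have "\<kappa> * norm (x - y) \<le> 0"
      using lower[of "x - y"] by (simp add: matrix_vector_mult_diff_distrib)
    then show "x = y"
      using \<open>0 < \<kappa>\<close> by (simp add: mult_le_0_iff)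
  qed
  then obtain D where "D ** C = mat 1"
    using matrix_left_invertible_injective by blast
  then have CD: "C ** D = mat 1"
    using matrix_left_right_inverse by blast
  have "norm (D *v z) \<le> norm z / \<kappa>" for z
    using lower[of "D *v z"] \<open>0 < \<kappa>\<close> by (simp add: matrix_vector_mul_assoc CD field_simps)
  with CD show thesis
    using that by blast
qed

context
  fixes U :: "real^'n^'m"
  assumes orthonormal_columns: "transpose U ** U = mat 1"
begin

lemma norm_orthonormal_columns_mult: "norm (U *v x) = norm x"
proof -
  have "inner (U *v x) (U *v x) = inner x x"
    by (subst inner_matrix_vector_transpose) (simp add: matrix_vector_mul_assoc orthonormal_columns)
  then show ?thesis
    by (simp add: norm_eq_sqrt_inner)
qed

lemma power2_norm_projection_split:
  "(norm y)\<^sup>2 = (norm (transpose U *v y))\<^sup>2 + (norm (y - U *v (transpose U *v y)))\<^sup>2"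
proof -
  let ?a = "transpose U *v y"
  let ?p = "U *v ?a"
  have "inner ?p y = inner ?a ?a"
    by (rule inner_matrix_vector_transpose)
  moreover have "inner ?p ?p = inner ?a ?a"
    by (subst inner_matrix_vector_transpose) (simp add: matrix_vector_mul_assoc orthonormal_columns)
  ultimately have "orthogonal ?p (y - ?p)"
    by (simp add: orthogonal_def inner_diff_right)
  from norm_add_Pythagorean[OF this] have "(norm y)\<^sup>2 = (norm ?p)\<^sup>2 + (norm (y - ?p))\<^sup>2"
    by simp
  then show ?thesis
    by (simp only: norm_orthonormal_columns_mult)
qed

lemma norm_transpose_orthonormal_le: "norm (transpose U *v y) \<le> norm y"
  by (rule power2_le_imp_le) (use power2_norm_projection_split[of y] in simp_all)

lemma norm_projection_complement_le: "norm (y - U *v (transpose U *v y)) \<le> norm y"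
  by (rule power2_le_imp_le) (use power2_norm_projection_split[of y] in simp_all)

lemma norm_projection_complement_mult_le:
  "norm ((E - U ** (transpose U ** E)) *v x) \<le> frob_norm E * norm x"
proof -
  have "(E - U ** (transpose U ** E)) *v x = E *v x - U *v (transpose U *v (E *v x))"
    by (simp del: transpose_matrix_vector add: matrix_vector_mult_diff_rdistrib
        matrix_vector_mul_assoc)
  then have "norm ((E - U ** (transpose U ** E)) *v x) \<le> norm (E *v x)"
    using norm_projection_complement_le by simp
  also have "\<dots> \<le> frob_norm E * norm x"
    by (rule norm_matrix_vector_le_frob_norm)
  finally show ?thesis .
qed

lemma frob_norm_projection_complement_le: "frob_norm (E - U ** (transpose U ** E)) \<le> frob_norm E"
proof (rule power2_le_imp_le)
  have "column j (E - U ** (transpose U ** E)) = column j E - U *v (transpose U *v column j E)" for j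
    by (simp only: matrix_vector_mult_basis[symmetric] matrix_vector_mult_diff_rdistrib
        matrix_vector_mul_assoc)
  then show "(frob_norm (E - U ** (transpose U ** E)))\<^sup>2 \<le> (frob_norm E)\<^sup>2"
    unfolding frob_norm_sq_columns
    by (metis (no_types, lifting) norm_ge_zero norm_projection_complement_le power_mono sum_mono)
qed (simp add: frob_norm_nonneg)

end

section \<open>The smallest singular value\<close>

lemma inner_symmetric_matrix:
  fixes G :: "real^'n^'n"
  assumes "transpose G = G"
  shows "inner (G *v x) y = inner x (G *v y)"
  using inner_matrix_vector_transpose[of G x y] assms by simp

lemma finite_eigenvalues_symmetric:
  fixes G :: "real^'n^'n"
  assumes sym: "transpose G = G"
  shows "finite (eigenvalues G)"
proof -
  define v where "v \<nu> = (SOME x. x \<noteq> 0 \<and> G *v x = \<nu> *s x)" for \<nu>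
  have v: "v \<nu> \<noteq> 0" "G *v v \<nu> = \<nu> *\<^sub>R v \<nu>" if "\<nu> \<in> eigenvalues G" for \<nu>
    using someI_ex[of "\<lambda>x. x \<noteq> 0 \<and> G *v x = \<nu> *s x"] that
    unfolding eigenvalues_def v_def by (auto simp: scalar_mult_eq_scaleR)
  have orth: "inner (v \<nu>) (v \<mu>) = 0"
    if "\<nu> \<in> eigenvalues G" "\<mu> \<in> eigenvalues G" "\<nu> \<noteq> \<mu>" for \<nu> \<mu>
  proof -
    have "\<nu> * inner (v \<nu>) (v \<mu>) = \<mu> * inner (v \<nu>) (v \<mu>)"
      using inner_symmetric_matrix[OF sym, of "v \<nu>" "v \<mu>"] v that by simp
    then show ?thesis
      using that(3) by simp
  qed
  have "inj_on v (eigenvalues G)"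
    by (rule inj_onI) (metis orth v(1) inner_eq_zero_iff)
  moreover have "independent (v ` eigenvalues G)"
    by (rule pairwise_orthogonal_independent)
      (use orth v in \<open>auto simp: pairwise_def orthogonal_def\<close>)
  then have "finite (v ` eigenvalues G)"
    using independent_bound by blast
  ultimately show ?thesis
    using finite_imageD by blast
qed

lemma linear_coeff_zero_if_quadratic_nonneg:
  fixes a b :: real
  assumes nonneg: "\<And>t. 0 \<le> 2 * t * a + t\<^sup>2 * b"
  shows "a = 0"
proof (rule ccontr)
  assume "a \<noteq> 0"
  define c where "c = \<bar>b\<bar> + 1"
  define t where "t = - a / c"
  have "c > 0" "\<bar>b\<bar> \<le> c"
    unfolding c_def by simp_all
  have "2 * t * a + t\<^sup>2 * b \<le> 2 * t * a + t\<^sup>2 * \<bar>b\<bar>"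
    by (simp add: mult_left_mono)
  also have "\<dots> = - 2 * a\<^sup>2 / c + (a\<^sup>2 / c) * (\<bar>b\<bar> / c)"
    using \<open>c > 0\<close> by (simp add: t_def power2_eq_square field_simps)
  also have "\<dots> \<le> - 2 * a\<^sup>2 / c + (a\<^sup>2 / c) * 1"
    using \<open>c > 0\<close> \<open>\<bar>b\<bar> \<le> c\<close> by (intro add_left_mono mult_left_mono) simp_all
  also have "\<dots> < 0"
    using \<open>c > 0\<close> \<open>a \<noteq> 0\<close> by (simp add: field_simps)
  finally show False
    using nonneg[of t] by simp
qed

lemma eigenvector_if_minimizes_rayleigh:
  fixes G :: "real^'n^'n"
  assumes sym: "transpose G = G" and "norm x = 1"
    and min: "\<And>y. inner (G *v x) x * (norm y)\<^sup>2 \<le> inner (G *v y) y"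
  shows "G *v x = inner (G *v x) x *s x"
proof -
  define \<mu> where "\<mu> = inner (G *v x) x"
  have "inner x x = 1"
    using \<open>norm x = 1\<close> by (metis power2_norm_eq_inner power_one)
  have "inner (G *v x - \<mu> *\<^sub>R x) y = 0" for y
  proof (rule linear_coeff_zero_if_quadratic_nonneg)
    fix t
    have "inner (G *v y) x = inner (G *v x) y"
      by (metis inner_symmetric_matrix[OF sym] inner_commute)
    have "\<mu> * (norm (x + t *\<^sub>R y))\<^sup>2 \<le> inner (G *v (x + t *\<^sub>R y)) (x + t *\<^sub>R y)"
      using min unfolding \<mu>_def .
    moreover have "(norm (x + t *\<^sub>R y))\<^sup>2 = 1 + 2 * t * inner x y + t\<^sup>2 * (norm y)\<^sup>2"
      using \<open>inner x x = 1\<close> unfolding power2_norm_eq_inner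
      by (simp add: inner_add_left inner_add_right inner_commute power2_eq_square algebra_simps)
    moreover have "inner (G *v (x + t *\<^sub>R y)) (x + t *\<^sub>R y)
        = \<mu> + 2 * t * inner (G *v x) y + t\<^sup>2 * inner (G *v y) y"
      using \<open>inner (G *v y) x = inner (G *v x) y\<close> unfolding \<mu>_def
      by (simp add: matrix_vector_right_distrib matrix_vector_mult_scaleR inner_add_left
          inner_add_right power2_eq_square algebra_simps)
    ultimately show "0 \<le> 2 * t * inner (G *v x - \<mu> *\<^sub>R x) y
        + t\<^sup>2 * (inner (G *v y) y - \<mu> * (norm y)\<^sup>2)"
      by (simp add: inner_diff_left algebra_simps)
  qed
  from this[of "G *v x - \<mu> *\<^sub>R x"] show ?thesis
    by (simp add: \<mu>_def scalar_mult_eq_scaleR)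
qed

lemma obtain_rayleigh_minimizer:
  fixes G :: "real^'n^'n"
  obtains x where "norm x = 1" and "\<And>y. inner (G *v x) x * (norm y)\<^sup>2 \<le> inner (G *v y) y"
proof -
  define q where "q y = inner (G *v y) y" for y
  have "continuous_on (sphere (0::real^'n) 1) q"
    unfolding q_def by (intro continuous_intros)
  moreover have "sphere (0::real^'n) 1 \<noteq> {}"
    by simp
  ultimately obtain x where x: "x \<in> sphere 0 1" and x_min: "\<And>y. y \<in> sphere 0 1 \<Longrightarrow> q x \<le> q y"
    using continuous_attains_inf[OF compact_sphere] by blast
  have "q x * (norm y)\<^sup>2 \<le> q y" for y
  proof (cases "y = 0")
    case False
    then have "q x \<le> q (y /\<^sub>R norm y)"
      by (intro x_min) simp
    also have "q (y /\<^sub>R norm y) = q y / (norm y)\<^sup>2"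
      using False by (simp add: q_def matrix_vector_mult_scaleR power2_eq_square field_simps)
    finally show ?thesis
      using False by (simp add: pos_le_divide_eq)
  qed (simp add: q_def)
  with x show thesis
    using that by (simp add: q_def)
qed

lemma Min_eigenvalues_symmetric:
  fixes G :: "real^'n^'n"
  assumes sym: "transpose G = G"
  shows "Min (eigenvalues G) \<in> eigenvalues G"
    and "Min (eigenvalues G) * (norm y)\<^sup>2 \<le> inner (G *v y) y"
proof -
  obtain x where "norm x = 1" and lower: "\<And>y. inner (G *v x) x * (norm y)\<^sup>2 \<le> inner (G *v y) y"
    using obtain_rayleigh_minimizer[of G] by blast
  define \<mu> where "\<mu> = inner (G *v x) x"
  have "G *v x = \<mu> *s x" and "x \<noteq> 0"
    using eigenvector_if_minimizes_rayleigh[OF sym \<open>norm x = 1\<close> lower] \<open>norm x = 1\<close>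
    by (auto simp: \<mu>_def)
  then have in_eig: "\<mu> \<in> eigenvalues G"
    unfolding eigenvalues_def by blast
  have "\<mu> \<le> \<nu>" if eig: "\<nu> \<in> eigenvalues G" for \<nu>
  proof -
    obtain z where "z \<noteq> 0" "G *v z = \<nu> *s z"
      using eig unfolding eigenvalues_def by blast
    then have "inner (G *v z) z = \<nu> * (norm z)\<^sup>2"
      unfolding power2_norm_eq_inner by (simp add: scalar_mult_eq_scaleR)
    then have "\<mu> * (norm z)\<^sup>2 \<le> \<nu> * (norm z)\<^sup>2"
      using lower[of z] by (simp add: \<mu>_def)
    then show ?thesis
      using \<open>z \<noteq> 0\<close> by simp
  qed
  then have "Min (eigenvalues G) = \<mu>"
    using in_eig finite_eigenvalues_symmetric[OF sym] by (intro antisym Min_le Min.boundedI) auto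
  then show "Min (eigenvalues G) \<in> eigenvalues G" "Min (eigenvalues G) * (norm y)\<^sup>2 \<le> inner (G *v y) y"
    using in_eig lower[of y] by (simp_all add: \<mu>_def)
qed

lemma sigma_r_lower_bound:
  fixes A :: "real^'n^'m"
  assumes "rank A = CARD('n)"
  shows "0 < sigma_r A" and "sigma_r A * norm x \<le> norm (A *v x)"
proof -
  define G where "G = transpose A ** A"
  define \<nu> where "\<nu> = Min (eigenvalues G)"
  have sym: "transpose G = G"
    by (simp add: G_def matrix_transpose_mul)
  have gram: "inner (G *v y) y = (norm (A *v y))\<^sup>2" for y
    by (simp add: G_def power2_norm_eq_inner inner_matrix_vector_transpose[of A y]
        matrix_vector_mul_assoc inner_commute)
  obtain z where "z \<noteq> 0" "G *v z = \<nu> *s z"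
    using Min_eigenvalues_symmetric(1)[OF sym] unfolding \<nu>_def eigenvalues_def by blast
  moreover have "A *v z \<noteq> 0"
    using \<open>z \<noteq> 0\<close> full_rank_injective[of A] assms unfolding inj_on_def
    by (metis UNIV_I matrix_vector_mult_0_right)
  ultimately have "0 < \<nu> * (norm z)\<^sup>2"
    using gram[of z] by (simp add: scalar_mult_eq_scaleR power2_norm_eq_inner)
  then have "0 < \<nu>"
    by (simp add: zero_less_mult_iff)
  then show "0 < sigma_r A"
    by (simp add: sigma_r_def G_def \<nu>_def)
  have "(sigma_r A * norm x)\<^sup>2 \<le> (norm (A *v x))\<^sup>2"
    using Min_eigenvalues_symmetric(2)[OF sym, of x] gram[of x] \<open>0 < \<nu>\<close>
    by (simp add: sigma_r_def G_def \<nu>_def power_mult_distrib)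
  then show "sigma_r A * norm x \<le> norm (A *v x)"
    by (rule power2_le_imp_le) simp
qed

section \<open>Perturbation of the left singular subspace\<close>

lemma top_left_singular_vectors_range:
  fixes U \<Phi> :: "real^'r^'s"
  assumes "top_left_singular_vectors U \<Phi>"
  shows "transpose U ** U = mat 1" and "U ** (transpose U ** \<Phi>) = \<Phi>"
proof -
  show UU: "transpose U ** U = mat 1"
    using assms by (simp add: top_left_singular_vectors_def)
  obtain S V :: "real^'r^'r" where "\<Phi> = U ** S ** transpose V"
    using assms unfolding top_left_singular_vectors_def by blast
  then show "U ** (transpose U ** \<Phi>) = \<Phi>"
    by (simp add: matrix_mul_assoc UU)
qed

lemma projection_of_perturbation:
  fixes U \<Phi> \<Phi>bar :: "real^'r^'s"
  assumes "U ** (transpose U ** \<Phi>) = \<Phi>"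
  shows "U ** (transpose U ** \<Phi>bar) = \<Phi>bar - ((\<Phi>bar - \<Phi>) - U ** (transpose U ** (\<Phi>bar - \<Phi>)))"
proof -
  have "U ** (transpose U ** \<Phi>bar) = U ** (transpose U ** (\<Phi> + (\<Phi>bar - \<Phi>)))"
    by simp
  also have "\<dots> = \<Phi> + U ** (transpose U ** (\<Phi>bar - \<Phi>))"
    by (simp only: matrix_add_ldistrib assms)
  finally show ?thesis
    by simp
qed

lemma projected_matrix_lower_bound:
  fixes U \<Phi> \<Phi>bar :: "real^'r^'s"
  assumes UU: "transpose U ** U = mat 1" and range_U: "U ** (transpose U ** \<Phi>) = \<Phi>"
    and lower: "\<And>x. \<sigma> * norm x \<le> norm (\<Phi>bar *v x)"
  shows "(\<sigma> - frob_norm (\<Phi>bar - \<Phi>)) * norm x \<le> norm ((transpose U ** \<Phi>bar) *v x)"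
proof -
  define F where "F = (\<Phi>bar - \<Phi>) - U ** (transpose U ** (\<Phi>bar - \<Phi>))"
  have "norm ((transpose U ** \<Phi>bar) *v x) = norm ((U ** (transpose U ** \<Phi>bar)) *v x)"
    using norm_orthonormal_columns_mult[OF UU, of "(transpose U ** \<Phi>bar) *v x"]
    by (simp only: matrix_vector_mul_assoc)
  also have "\<dots> = norm (\<Phi>bar *v x - F *v x)"
    unfolding projection_of_perturbation[OF range_U, of \<Phi>bar] F_def
    by (simp add: matrix_vector_mult_diff_rdistrib matrix_vector_mult_add_rdistrib)
  finally have "norm ((transpose U ** \<Phi>bar) *v x) = norm (\<Phi>bar *v x - F *v x)" .
  moreover have "norm (\<Phi>bar *v x) - norm (F *v x) \<le> norm (\<Phi>bar *v x - F *v x)"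
    by (rule norm_triangle_ineq2)
  moreover have "norm (F *v x) \<le> frob_norm (\<Phi>bar - \<Phi>) * norm x"
    unfolding F_def by (rule norm_projection_complement_mult_le[OF UU])
  ultimately show ?thesis
    using lower[of x] unfolding left_diff_distrib by linarith
qed

(* The witness is D = (U^T Phibar)^-1, for which U - Phibar D = -(I - U U^T)(Phibar - Phi) D. *)
lemma singular_vectors_near_row_space:
  fixes U \<Phi> \<Phi>bar :: "real^'r::finite^'s"
  assumes UU: "transpose U ** U = mat 1" and range_U: "U ** (transpose U ** \<Phi>) = \<Phi>"
    and lower: "\<And>x. \<sigma> * norm x \<le> norm (\<Phi>bar *v x)"
    and small: "frob_norm (\<Phi>bar - \<Phi>) < \<sigma>"
  obtains D :: "real^'r^'r" where "transpose U ** (\<Phi>bar ** D) = mat 1"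
    and "frob_norm (U - \<Phi>bar ** D) \<le> frob_norm (\<Phi>bar - \<Phi>) / (\<sigma> - frob_norm (\<Phi>bar - \<Phi>))"
proof -
  define \<Delta> where "\<Delta> = frob_norm (\<Phi>bar - \<Phi>)"
  define F where "F = (\<Phi>bar - \<Phi>) - U ** (transpose U ** (\<Phi>bar - \<Phi>))"
  define C where "C = transpose U ** \<Phi>bar"
  have "0 < \<sigma> - \<Delta>"
    using small by (simp add: \<Delta>_def)
  moreover have "(\<sigma> - \<Delta>) * norm x \<le> norm (C *v x)" for x
    unfolding C_def \<Delta>_def by (rule projected_matrix_lower_bound[OF UU range_U lower])
  ultimately obtain D where CD: "C ** D = mat 1" and D_bound: "\<And>z. norm (D *v z) \<le> norm z / (\<sigma> - \<Delta>)"
    using exists_right_inverse_norm_le by blast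
  have "U = (U ** C) ** D"
    by (simp add: CD flip: matrix_mul_assoc)
  also have "\<dots> = \<Phi>bar ** D - F ** D"
    unfolding C_def projection_of_perturbation[OF range_U, of \<Phi>bar] F_def[symmetric]
    by (rule matrix_diff_rdistrib)
  finally have "U - \<Phi>bar ** D = - (F ** D)"
    by simp
  then have "frob_norm (U - \<Phi>bar ** D) = frob_norm (F ** D)"
    by simp
  also have "\<dots> \<le> 1 / (\<sigma> - \<Delta>) * frob_norm F"
    using D_bound \<open>0 < \<sigma> - \<Delta>\<close> by (intro frob_norm_matrix_mult_le) simp_all
  also have "\<dots> \<le> 1 / (\<sigma> - \<Delta>) * \<Delta>"
    using \<open>0 < \<sigma> - \<Delta>\<close> frob_norm_projection_complement_le[OF UU, of "\<Phi>bar - \<Phi>"]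
    by (intro mult_left_mono) (simp_all add: F_def \<Delta>_def)
  finally have "frob_norm (U - \<Phi>bar ** D) \<le> \<Delta> / (\<sigma> - \<Delta>)"
    by simp
  moreover have "transpose U ** (\<Phi>bar ** D) = mat 1"
    by (simp add: matrix_mul_assoc C_def[symmetric] CD)
  ultimately show thesis
    using that by (simp add: \<Delta>_def)
qed

section \<open>Partitions and k-means\<close>

(* Meaningful only for a partition; otherwise THE yields an arbitrary label. *)
definition cluster_of :: "('r \<Rightarrow> 's set) \<Rightarrow> 's \<Rightarrow> 'r" where
  "cluster_of \<Omega> i = (THE k. i \<in> \<Omega> k)"

context
  fixes \<Omega> :: "'r \<Rightarrow> 's set"
  assumes partition: "is_partition \<Omega>"
begin

lemma ex1_cluster: "\<exists>!k. i \<in> \<Omega> k"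
  using partition unfolding is_partition_def by blast

lemma cluster_of_mem: "i \<in> \<Omega> (cluster_of \<Omega> i)"
  unfolding cluster_of_def by (rule theI') (rule ex1_cluster)

lemma cluster_of_eqI: "i \<in> \<Omega> k \<Longrightarrow> cluster_of \<Omega> i = k"
  using cluster_of_mem ex1_cluster by blast

lemma cluster_of_eq_iff: "cluster_of \<Omega> i = k \<longleftrightarrow> i \<in> \<Omega> k"
  using cluster_of_mem cluster_of_eqI by blast

end

lemma sum_over_partition:
  fixes \<Omega> :: "'r::finite \<Rightarrow> 's::finite set"
  assumes "is_partition \<Omega>"
  shows "(\<Sum>k\<in>UNIV. \<Sum>i\<in>\<Omega> k. f i) = (\<Sum>i\<in>UNIV. f i)"
proof -
  have "(\<Sum>k\<in>UNIV. \<Sum>i\<in>\<Omega> k. f i) = sum f (\<Union>k. \<Omega> k)"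
    using assms by (subst sum.UNION_disjoint) (auto simp: is_partition_def)
  then show ?thesis
    using assms by (simp add: is_partition_def)
qed

lemma card_cluster_pos: "is_partition (\<Omega> :: 'r \<Rightarrow> 's::finite set) \<Longrightarrow> 0 < card (\<Omega> k)"
  by (simp add: is_partition_def card_gt_0_iff)

lemma card_le_max_cluster_size: "card (\<Omega> k) \<le> max_cluster_size (\<Omega> :: 'r::finite \<Rightarrow> 's set)"
  unfolding max_cluster_size_def by (rule Max_ge) auto

lemma min_cluster_size_le_card: "min_cluster_size (\<Omega> :: 'r::finite \<Rightarrow> 's set) \<le> card (\<Omega> k)"
  unfolding min_cluster_size_def by (rule Min_le) auto

lemma kmeans_opt_le_obj: "is_partition \<Omega> \<Longrightarrow> kmeans_opt U \<le> kmeans_obj U \<Omega> c"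
  unfolding kmeans_opt_def kmeans_obj_def
  by (rule cInf_lower) (auto intro!: bdd_belowI[of _ 0] sum_nonneg)

lemma kmeans_obj_eq_sum_rows:
  assumes "is_partition \<Omega>"
  shows "kmeans_obj U \<Omega> c = (\<Sum>i\<in>UNIV. (norm (U $ i - c (cluster_of \<Omega> i)))\<^sup>2)"
  unfolding kmeans_obj_def
  by (simp add: cluster_of_eqI[OF assms] sum_over_partition[OF assms, symmetric] cong: sum.cong)

lemma kmeans_obj_rows_constant:
  assumes "is_partition \<Omega>" and "\<And>i. M $ i = m (cluster_of \<Omega> i)"
  shows "kmeans_obj U \<Omega> m = (frob_norm (U - M))\<^sup>2"
  using assms by (simp add: kmeans_obj_eq_sum_rows frob_norm_sq_rows)

lemma approx_kmeans_centers_close: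
  fixes U M :: "real^'r::finite^'s::finite" and \<Omega> :: "'r \<Rightarrow> 's set"
  assumes sol: "approx_kmeans_solution \<epsilon> U \<Omega>h ch" and "0 \<le> \<epsilon>"
    and "is_partition \<Omega>" and "\<And>i. M $ i = m (cluster_of \<Omega> i)"
  shows "(\<Sum>i\<in>UNIV. (dist (ch (cluster_of \<Omega>h i)) (M $ i))\<^sup>2) \<le> 2 * (2 + \<epsilon>) * (frob_norm (U - M))\<^sup>2"
proof -
  let ?c = "\<lambda>i. ch (cluster_of \<Omega>h i)"
  have partition_h: "is_partition \<Omega>h"
    using sol by (simp add: approx_kmeans_solution_def)
  have "kmeans_obj U \<Omega>h ch \<le> (1 + \<epsilon>) * kmeans_opt U"
    using sol by (simp add: approx_kmeans_solution_def)
  also have "\<dots> \<le> (1 + \<epsilon>) * (frob_norm (U - M))\<^sup>2"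
    using kmeans_opt_le_obj[OF assms(3), of U m] kmeans_obj_rows_constant[OF assms(3,4)] \<open>0 \<le> \<epsilon>\<close>
    by (intro mult_left_mono) simp_all
  finally have obj: "(\<Sum>i\<in>UNIV. (norm (U $ i - ?c i))\<^sup>2) \<le> (1 + \<epsilon>) * (frob_norm (U - M))\<^sup>2"
    by (simp add: kmeans_obj_eq_sum_rows[OF partition_h])
  have "(dist (?c i) (M $ i))\<^sup>2 \<le> 2 * (norm (U $ i - ?c i))\<^sup>2 + 2 * (norm ((U - M) $ i))\<^sup>2" for i
  proof -
    let ?a = "norm (U $ i - ?c i)" and ?b = "norm ((U - M) $ i)"
    have "?c i - M $ i = - (U $ i - ?c i) + (U - M) $ i"
      by simp
    then have "dist (?c i) (M $ i) \<le> ?a + ?b"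
      using norm_triangle_ineq[of "- (U $ i - ?c i)" "(U - M) $ i"]
      by (simp only: dist_norm norm_minus_cancel)
    then have "(dist (?c i) (M $ i))\<^sup>2 \<le> (?a + ?b)\<^sup>2"
      by (simp add: power_mono)
    also have "\<dots> \<le> 2 * ?a\<^sup>2 + 2 * ?b\<^sup>2"
      using power2_sum[of ?a ?b] power2_diff[of ?a ?b] zero_le_power2[of "?a - ?b"] by linarith
    finally show ?thesis .
  qed
  then have "(\<Sum>i\<in>UNIV. (dist (?c i) (M $ i))\<^sup>2)
      \<le> 2 * (\<Sum>i\<in>UNIV. (norm (U $ i - ?c i))\<^sup>2) + 2 * (frob_norm (U - M))\<^sup>2"
    by (simp add: frob_norm_sq_rows sum_distrib_left sum.distrib[symmetric] sum_mono)
  then show ?thesis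
    using obj by (simp add: algebra_simps)
qed

section \<open>Separation of the cluster centres\<close>

lemma indicator_in_column_space:
  fixes M :: "real^'r::finite^'s" and \<Omega> :: "'r \<Rightarrow> 's set"
  assumes partition: "is_partition \<Omega>" and "inj ((*v) M)"
    and rows: "\<And>i. M $ i = m (cluster_of \<Omega> i)"
  obtains w where "M *v w = (\<chi> i. if i \<in> \<Omega> k then 1 else 0)"
proof -
  define B :: "real^'r^'r" where "B = (\<chi> k. m k)"
  have row: "(M *v w) $ i = (B *v w) $ cluster_of \<Omega> i" for w i
    by (simp add: matrix_vector_mul_component B_def rows)
  have "inj ((*v) B)"
  proof (rule injI)
    fix w w' assume "B *v w = B *v w'"
    then have "M *v w = M *v w'"
      by (simp add: vec_eq_iff row)
    then show "w = w'"
      using \<open>inj ((*v) M)\<close> by (simp add: inj_eq)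
  qed
  then obtain w where "B *v w = axis k 1"
    using linear_injective_imp_surjective[OF matrix_vector_mul_linear[of B]] by (metis surjD)
  then have "M *v w = (\<chi> i. if i \<in> \<Omega> k then 1 else 0)"
    by (simp add: vec_eq_iff row axis_def cluster_of_eq_iff[OF partition])
  then show thesis ..
qed

lemma transpose_mult_cluster_indicator:
  fixes M :: "real^'n^'s::finite" and \<Omega> :: "'r \<Rightarrow> 's set"
  assumes partition: "is_partition \<Omega>" and rows: "\<And>i. M $ i = m (cluster_of \<Omega> i)"
  shows "transpose M *v (\<chi> i. if i \<in> \<Omega> k then 1 else 0) = real (card (\<Omega> k)) *\<^sub>R m k"
proof -
  have "(transpose M *v (\<chi> i. if i \<in> \<Omega> k then 1 else 0)) $ j
      = (\<Sum>i\<in>UNIV. if i \<in> \<Omega> k then m k $ j else 0)" for j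
    unfolding transpose_matrix_vector vector_matrix_mult_def
    by (auto intro!: sum.cong simp: rows cluster_of_eqI[OF partition])
  then show ?thesis
    by (simp add: vec_eq_iff sum.If_cases)
qed

(* No nonemptiness hypothesis is needed: for an empty set both 1/card and its term vanish. *)
lemma power2_norm_normalized_indicator_diff:
  fixes A B :: "'s::finite set"
  assumes "A \<inter> B = {}"
  shows "(norm ((1 / real (card A)) *\<^sub>R (\<chi> i. if i \<in> A then 1 else 0)
      - (1 / real (card B)) *\<^sub>R (\<chi> i. if i \<in> B then 1 else 0) :: real^'s))\<^sup>2
    = 1 / real (card A) + 1 / real (card B)"
proof -
  let ?v = "(1 / real (card A)) *\<^sub>R (\<chi> i. if i \<in> A then 1 else 0)
      - (1 / real (card B)) *\<^sub>R (\<chi> i. if i \<in> B then 1 else 0) :: real^'s"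
  have "(?v $ i)\<^sup>2 = (if i \<in> A then 1 / (real (card A))\<^sup>2 else 0)
      + (if i \<in> B then 1 / (real (card B))\<^sup>2 else 0)" for i
    using assms by (auto simp: power_divide)
  then have "(norm ?v)\<^sup>2 = real (card A) * (1 / (real (card A))\<^sup>2) + real (card B) * (1 / (real (card B))\<^sup>2)"
    by (simp add: power2_norm_vec sum.distrib sum.If_cases)
  then show ?thesis
    by (simp add: power2_eq_square)
qed

(* The normalised indicator difference v = z_k / n_k - z_l / n_l lies in the column space of M,
   say v = M u; then |v|^2 = <M^T v, u> = <m_k - m_l, u>, and |u| = |U^T v| <= |v|. *)
lemma cluster_centers_separated:
  fixes U M :: "real^'r::finite^'s::finite" and \<Omega> :: "'r \<Rightarrow> 's set"
  assumes UU: "transpose U ** U = mat 1" and UM: "transpose U ** M = mat 1"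
    and partition: "is_partition \<Omega>" and rows: "\<And>i. M $ i = m (cluster_of \<Omega> i)"
    and "k \<noteq> l"
  shows "1 / real (card (\<Omega> k)) + 1 / real (card (\<Omega> l)) \<le> (dist (m k) (m l))\<^sup>2"
proof -
  define n where "n j = real (card (\<Omega> j))" for j
  define z :: "'r \<Rightarrow> real^'s" where "z j = (\<chi> i. if i \<in> \<Omega> j then 1 else 0)" for j
  have n_pos: "0 < n j" for j
    unfolding n_def using card_cluster_pos[OF partition] by simp
  have "inj ((*v) M)"
    using UM matrix_left_invertible_injective by blast
  then obtain wk wl where wk: "M *v wk = z k" and wl: "M *v wl = z l"
    using indicator_in_column_space[OF partition _ rows] unfolding z_def by metis
  define v where "v = (1 / n k) *\<^sub>R z k - (1 / n l) *\<^sub>R z l"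
  define u where "u = (1 / n k) *\<^sub>R wk - (1 / n l) *\<^sub>R wl"
  have Mu: "M *v u = v"
    by (simp add: u_def v_def wk wl matrix_vector_mult_diff_distrib matrix_vector_mult_scaleR)
  have MTv: "transpose M *v v = m k - m l"
    using n_pos[of k] n_pos[of l] transpose_mult_cluster_indicator[OF partition rows]
    unfolding v_def z_def n_def
    by (simp del: transpose_matrix_vector add: matrix_vector_mult_diff_distrib matrix_vector_mult_scaleR
        card_gt_0_iff)
  have UTv: "transpose U *v v = u"
    by (simp del: transpose_matrix_vector add: Mu[symmetric] matrix_vector_mul_assoc UM)
  have norm_v: "(norm v)\<^sup>2 = 1 / n k + 1 / n l"
    using partition \<open>k \<noteq> l\<close> unfolding v_def z_def n_def is_partition_def
    by (intro power2_norm_normalized_indicator_diff) blast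
  have "(norm v)\<^sup>2 = inner (transpose M *v v) u"
    by (simp del: transpose_matrix_vector add: power2_norm_eq_inner Mu[symmetric]
        inner_matrix_vector_transpose inner_commute)
  also have "\<dots> \<le> dist (m k) (m l) * norm u"
    unfolding MTv dist_norm by (rule Cauchy_Schwarz_ineq2[THEN abs_le_D1])
  also have "\<dots> \<le> dist (m k) (m l) * norm v"
    unfolding UTv[symmetric] by (intro mult_left_mono norm_transpose_orthonormal_le[OF UU]) simp
  finally have "norm v * norm v \<le> dist (m k) (m l) * norm v"
    by (simp add: power2_eq_square)
  moreover have "0 < norm v"
    using norm_v n_pos[of k] n_pos[of l] by (metis add_pos_pos divide_pos_pos zero_less_norm_iff
        norm_zero zero_less_one zero_power2 less_irrefl)
  ultimately have "norm v \<le> dist (m k) (m l)"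
    by (rule mult_right_le_imp_le)
  then have "(norm v)\<^sup>2 \<le> (dist (m k) (m l))\<^sup>2"
    by (simp add: power_mono)
  then show ?thesis
    using norm_v by (simp add: n_def)
qed

section \<open>Misclustering\<close>

lemma misclustering_rate_le:
  fixes \<Omega> \<Omega>h :: "'r::finite \<Rightarrow> 's set"
  assumes "bij h"
  shows "misclustering_rate \<Omega> \<Omega>h
    \<le> (\<Sum>k\<in>UNIV. real (card {i. i \<in> \<Omega> k \<and> i \<notin> \<Omega>h (h k)}) / real (card (\<Omega> k)))"
  unfolding misclustering_rate_def using assms by (intro Min_le) (auto simp: finite_image_set)

(* Each true cluster has a point outside S k; the estimated cluster of that point, which is near
   m k, defines a bijection h between true and estimated clusters. *)
lemma misclustering_rate_le_sum_far:
  fixes \<Omega> \<Omega>h :: "'r::finite \<Rightarrow> 's::finite set" and c m :: "'r \<Rightarrow> 'a::metric_space"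
  assumes partition_h: "is_partition \<Omega>h"
    and separated: "\<And>k l. k \<noteq> l \<Longrightarrow> \<delta> k + \<delta> l \<le> 2 * dist (m k) (m l)"
    and far_proper: "\<And>k. S k \<subset> \<Omega> k"
    and near: "\<And>k i. i \<in> \<Omega> k - S k \<Longrightarrow> 2 * dist (c (cluster_of \<Omega>h i)) (m k) < \<delta> k"
  shows "misclustering_rate \<Omega> \<Omega>h \<le> (\<Sum>k\<in>UNIV. real (card (S k)) / real (card (\<Omega> k)))"
proof -
  have unique: "k = l" if "2 * dist x (m k) < \<delta> k" "2 * dist x (m l) < \<delta> l" for x k l
  proof (rule ccontr)
    assume "k \<noteq> l"
    then show False
      using separated[of k l] dist_triangle3[of "m k" "m l" x] that by simp
  qed
  obtain rep where rep: "\<And>k. rep k \<in> \<Omega> k - S k"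
    using choice[of "\<lambda>k i. i \<in> \<Omega> k - S k"] far_proper psubset_imp_ex_mem by metis
  define h where "h k = cluster_of \<Omega>h (rep k)" for k
  have near_h: "2 * dist (c (h k)) (m k) < \<delta> k" for k
    unfolding h_def by (rule near[OF rep])
  have "inj h"
    by (rule injI) (use near_h unique in metis)
  then have "bij h"
    by (simp add: bij_def finite_UNIV_inj_surj)
  have misplaced: "{i. i \<in> \<Omega> k \<and> i \<notin> \<Omega>h (h k)} \<subseteq> S k" for k
  proof (rule subsetI, rule ccontr)
    fix i assume i: "i \<in> {i. i \<in> \<Omega> k \<and> i \<notin> \<Omega>h (h k)}" "i \<notin> S k"
    obtain l where l: "cluster_of \<Omega>h i = h l"
      using \<open>bij h\<close> by (metis bij_pointE)
    have "2 * dist (c (h l)) (m k) < \<delta> k"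
      using near[of i k] i l by simp
    then have "k = l"
      using near_h[of l] unique by blast
    then show False
      using cluster_of_mem[OF partition_h, of i] i l by simp
  qed
  have "misclustering_rate \<Omega> \<Omega>h
      \<le> (\<Sum>k\<in>UNIV. real (card {i. i \<in> \<Omega> k \<and> i \<notin> \<Omega>h (h k)}) / real (card (\<Omega> k)))"
    by (rule misclustering_rate_le[OF \<open>bij h\<close>])
  also have "\<dots> \<le> (\<Sum>k\<in>UNIV. real (card (S k)) / real (card (\<Omega> k)))"
    using misplaced by (intro sum_mono divide_right_mono) (simp_all add: card_mono)
  finally show ?thesis .
qed

lemma sum_card_far_le:
  fixes \<Omega> :: "'r::finite \<Rightarrow> 's::finite set"
  assumes partition: "is_partition \<Omega>" and "\<And>k. 0 \<le> \<delta> k"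
  shows "(\<Sum>k\<in>UNIV. real (card {i \<in> \<Omega> k. \<delta> k \<le> 2 * e i}) * (\<delta> k)\<^sup>2) \<le> 4 * (\<Sum>i\<in>UNIV. (e i)\<^sup>2)"
proof -
  have "real (card {i \<in> \<Omega> k. \<delta> k \<le> 2 * e i}) * (\<delta> k)\<^sup>2 \<le> (\<Sum>i\<in>\<Omega> k. 4 * (e i)\<^sup>2)" for k
  proof -
    have "real (card {i \<in> \<Omega> k. \<delta> k \<le> 2 * e i}) * (\<delta> k)\<^sup>2 = (\<Sum>i\<in>{i \<in> \<Omega> k. \<delta> k \<le> 2 * e i}. (\<delta> k)\<^sup>2)"
      by simp
    also have "\<dots> \<le> (\<Sum>i\<in>{i \<in> \<Omega> k. \<delta> k \<le> 2 * e i}. 4 * (e i)\<^sup>2)"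
      using assms(2)[of k] by (intro sum_mono) (auto simp: power_mono[of "\<delta> k" "2 * e _" 2, simplified])
    also have "\<dots> \<le> (\<Sum>i\<in>\<Omega> k. 4 * (e i)\<^sup>2)"
      by (intro sum_mono2) auto
    finally show ?thesis .
  qed
  then have "(\<Sum>k\<in>UNIV. real (card {i \<in> \<Omega> k. \<delta> k \<le> 2 * e i}) * (\<delta> k)\<^sup>2)
      \<le> (\<Sum>k\<in>UNIV. \<Sum>i\<in>\<Omega> k. 4 * (e i)\<^sup>2)"
    by (rule sum_mono)
  also have "\<dots> = 4 * (\<Sum>i\<in>UNIV. (e i)\<^sup>2)"
    by (simp add: sum_over_partition[OF partition] sum_distrib_left)
  finally show ?thesis .
qed

lemma misclustering_rate_le_center_errors:
  fixes \<Omega> \<Omega>h :: "'r::finite \<Rightarrow> 's::finite set" and c m :: "'r \<Rightarrow> 'a::metric_space"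
  defines "e \<equiv> \<lambda>i. dist (c (cluster_of \<Omega>h i)) (m (cluster_of \<Omega> i))"
  assumes partition: "is_partition \<Omega>" and partition_h: "is_partition \<Omega>h"
    and separated: "\<And>k l. k \<noteq> l \<Longrightarrow> \<delta> k + \<delta> l \<le> 2 * dist (m k) (m l)"
    and \<delta>_nonneg: "\<And>k. 0 \<le> \<delta> k" and \<delta>_large: "\<And>k. 1 \<le> real (card (\<Omega> k)) * (\<delta> k)\<^sup>2"
    and small: "\<And>k. 4 * (\<Sum>i\<in>UNIV. (e i)\<^sup>2) < real (card (\<Omega> k)) * (\<delta> k)\<^sup>2"
  shows "misclustering_rate \<Omega> \<Omega>h \<le> 4 * (\<Sum>i\<in>UNIV. (e i)\<^sup>2)"
proof -
  define S where "S k = {i \<in> \<Omega> k. \<delta> k \<le> 2 * e i}" for k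
  have far: "(\<Sum>k\<in>UNIV. real (card (S k)) * (\<delta> k)\<^sup>2) \<le> 4 * (\<Sum>i\<in>UNIV. (e i)\<^sup>2)"
    unfolding S_def by (rule sum_card_far_le[OF partition \<delta>_nonneg])
  have "S k \<subset> \<Omega> k" for k
  proof -
    have "real (card (S k)) * (\<delta> k)\<^sup>2 \<le> 4 * (\<Sum>i\<in>UNIV. (e i)\<^sup>2)"
      using far member_le_sum[of k UNIV "\<lambda>k. real (card (S k)) * (\<delta> k)\<^sup>2"] by simp
    also have "\<dots> < real (card (\<Omega> k)) * (\<delta> k)\<^sup>2"
      by (rule small)
    finally have "real (card (S k)) < real (card (\<Omega> k))"
      by (rule mult_right_less_imp_less) simp
    then show ?thesis
      by (auto simp: S_def)
  qed
  moreover have "2 * dist (c (cluster_of \<Omega>h i)) (m k) < \<delta> k" if "i \<in> \<Omega> k - S k" for k i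
    using that cluster_of_eqI[OF partition] by (auto simp: S_def e_def)
  ultimately have "misclustering_rate \<Omega> \<Omega>h \<le> (\<Sum>k\<in>UNIV. real (card (S k)) / real (card (\<Omega> k)))"
    using misclustering_rate_le_sum_far[where m = m and \<delta> = \<delta> and c = c, OF partition_h separated]
    by blast
  also have "\<dots> \<le> (\<Sum>k\<in>UNIV. real (card (S k)) * (\<delta> k)\<^sup>2)"
  proof (rule sum_mono)
    fix k
    have "1 / real (card (\<Omega> k)) \<le> (\<delta> k)\<^sup>2"
      using \<delta>_large[of k] card_cluster_pos[OF partition, of k] by (simp add: divide_le_eq mult.commute)
    then show "real (card (S k)) / real (card (\<Omega> k)) \<le> real (card (S k)) * (\<delta> k)\<^sup>2"
      by (metis mult_left_mono of_nat_0_le_iff times_divide_eq_right mult.right_neutral)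
  qed
  also have "\<dots> \<le> 4 * (\<Sum>i\<in>UNIV. (e i)\<^sup>2)"
    by (rule far)
  finally show ?thesis .
qed

lemma cluster_radius_bounds:
  fixes \<Omega> :: "'r::finite \<Rightarrow> 's::finite set"
  defines "\<delta> \<equiv> \<lambda>k. sqrt (1 / real (card (\<Omega> k)) + 1 / real (max_cluster_size \<Omega>))"
  assumes "is_partition \<Omega>"
  shows "0 \<le> \<delta> k"
    and "(\<delta> k)\<^sup>2 \<le> 1 / real (card (\<Omega> k)) + 1 / real (card (\<Omega> l))"
    and "1 + real (min_cluster_size \<Omega>) / real (max_cluster_size \<Omega>) \<le> real (card (\<Omega> k)) * (\<delta> k)\<^sup>2"
proof -
  define n where "n k = real (card (\<Omega> k))" for k
  define N where "N = real (max_cluster_size \<Omega>)"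
  have n_pos: "0 < n k" and n_le: "n k \<le> N" for k
    using card_cluster_pos[OF assms(2)] card_le_max_cluster_size[of \<Omega> k] by (simp_all add: n_def N_def)
  then have "0 < N"
    by (meson less_le_trans)
  then have \<delta>_sq: "(\<delta> k)\<^sup>2 = 1 / n k + 1 / N" and n_\<delta>_sq: "n k * (\<delta> k)\<^sup>2 = 1 + n k / N" for k
    using n_pos[of k] by (simp_all add: \<delta>_def n_def[symmetric] N_def[symmetric] field_simps
        add_pos_pos less_imp_le)
  show "0 \<le> \<delta> k"
    using n_pos[of k] \<open>0 < N\<close> by (simp add: \<delta>_def n_def[symmetric] N_def[symmetric])
  show "(\<delta> k)\<^sup>2 \<le> 1 / real (card (\<Omega> k)) + 1 / real (card (\<Omega> l))"
    using n_pos[of l] n_le[of l] by (simp add: \<delta>_sq frac_le n_def)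
  show "1 + real (min_cluster_size \<Omega>) / real (max_cluster_size \<Omega>) \<le> real (card (\<Omega> k)) * (\<delta> k)\<^sup>2"
    using min_cluster_size_le_card[of \<Omega> k] \<open>0 < N\<close>
    by (simp add: n_\<delta>_sq[unfolded n_def] N_def divide_right_mono)
qed

lemma misclustering_rate_le_kmeans_cost:
  fixes U M :: "real^'r::finite^'s::finite" and \<Omega> \<Omega>h :: "'r \<Rightarrow> 's set"
  assumes "0 \<le> \<epsilon>" and partition: "is_partition \<Omega>" and sol: "approx_kmeans_solution \<epsilon> U \<Omega>h ch"
    and UU: "transpose U ** U = mat 1" and UM: "transpose U ** M = mat 1"
    and rows_const: "\<And>k i i'. i \<in> \<Omega> k \<Longrightarrow> i' \<in> \<Omega> k \<Longrightarrow> M $ i = M $ i'"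
    and small: "8 * (2 + \<epsilon>) * (frob_norm (U - M))\<^sup>2
      < 1 + real (min_cluster_size \<Omega>) / real (max_cluster_size \<Omega>)"
  shows "misclustering_rate \<Omega> \<Omega>h \<le> 8 * (2 + \<epsilon>) * (frob_norm (U - M))\<^sup>2"
proof -
  define m where "m k = M $ (SOME i. i \<in> \<Omega> k)" for k
  define \<delta> where "\<delta> k = sqrt (1 / real (card (\<Omega> k)) + 1 / real (max_cluster_size \<Omega>))" for k
  note radius = cluster_radius_bounds[OF partition, folded \<delta>_def]
  have rows: "M $ i = m (cluster_of \<Omega> i)" for i
    unfolding m_def using rows_const cluster_of_mem[OF partition] by (metis someI_ex)
  have \<delta>_le: "\<delta> k \<le> dist (m k) (m l)" if "k \<noteq> l" for k l
  proof (rule power2_le_imp_le)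
    show "(\<delta> k)\<^sup>2 \<le> (dist (m k) (m l))\<^sup>2"
      using radius(2)[of k l] cluster_centers_separated[OF UU UM partition rows that] by linarith
  qed simp
  have errors: "4 * (\<Sum>i\<in>UNIV. (dist (ch (cluster_of \<Omega>h i)) (m (cluster_of \<Omega> i)))\<^sup>2)
      \<le> 8 * (2 + \<epsilon>) * (frob_norm (U - M))\<^sup>2"
    using mult_left_mono[OF approx_kmeans_centers_close[OF sol \<open>0 \<le> \<epsilon>\<close> partition rows], where c = 4]
    by (simp add: rows algebra_simps)
  have "misclustering_rate \<Omega> \<Omega>h
      \<le> 4 * (\<Sum>i\<in>UNIV. (dist (ch (cluster_of \<Omega>h i)) (m (cluster_of \<Omega> i)))\<^sup>2)"
  proof (rule misclustering_rate_le_center_errors[where c = ch and m = m and \<delta> = \<delta>, OF partition])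
    show "is_partition \<Omega>h"
      using sol by (simp add: approx_kmeans_solution_def)
    show "\<delta> k + \<delta> l \<le> 2 * dist (m k) (m l)" if "k \<noteq> l" for k l
      using \<delta>_le[OF that] \<delta>_le[of l k] that by (simp add: dist_commute)
    show "0 \<le> \<delta> k" for k
      by (rule radius(1))
    show "1 \<le> real (card (\<Omega> k)) * (\<delta> k)\<^sup>2" for k
      using radius(3)[of k] by (smt (verit) divide_nonneg_nonneg of_nat_0_le_iff)
    show "4 * (\<Sum>i\<in>UNIV. (dist (ch (cluster_of \<Omega>h i)) (m (cluster_of \<Omega> i)))\<^sup>2)
        < real (card (\<Omega> k)) * (\<delta> k)\<^sup>2" for k
      using errors small radius(3)[of k] by linarith
  qed
  with errors show ?thesis
    by linarith
qed

lemma noise_condition_squared: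
  fixes \<sigma> \<Delta> \<epsilon> :: real and nmin nmax :: nat
  assumes "0 \<le> \<epsilon>" "0 \<le> \<Delta>" "0 < nmax" "nmin \<le> nmax"
    and noise: "\<Delta> \<le> \<sigma> * sqrt (real (nmin + nmax)) / (8 * sqrt ((2 + \<epsilon>) * real nmax))"
  shows "(2 + \<epsilon>) * \<Delta>\<^sup>2 \<le> \<sigma>\<^sup>2 / 32"
proof -
  have "\<Delta>\<^sup>2 \<le> (\<sigma> * sqrt (real (nmin + nmax)) / (8 * sqrt ((2 + \<epsilon>) * real nmax)))\<^sup>2"
    using noise \<open>0 \<le> \<Delta>\<close> by (rule power_mono)
  also have "\<dots> = \<sigma>\<^sup>2 * (real nmin + real nmax) / (64 * ((2 + \<epsilon>) * real nmax))"
    using assms(1,3) by (simp add: power_divide power_mult_distrib)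
  also have "\<dots> \<le> \<sigma>\<^sup>2 * (2 * real nmax) / (64 * ((2 + \<epsilon>) * real nmax))"
    using assms(1,3,4) by (intro divide_right_mono mult_left_mono) simp_all
  also have "\<dots> = \<sigma>\<^sup>2 * 2 / (64 * (2 + \<epsilon>))"
    using assms(3) by simp
  finally have "\<Delta>\<^sup>2 * (64 * (2 + \<epsilon>)) \<le> \<sigma>\<^sup>2 * 2"
    using assms(1) by (simp add: pos_le_divide_eq)
  moreover have "\<Delta>\<^sup>2 * (64 * (2 + \<epsilon>)) = 64 * ((2 + \<epsilon>) * \<Delta>\<^sup>2)"
    by (simp add: algebra_simps)
  ultimately show ?thesis
    by linarith
qed

lemma noise_condition_bounds:
  fixes \<sigma> \<Delta> \<epsilon> :: real and nmin nmax :: nat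
  assumes "0 < \<sigma>" "0 \<le> \<epsilon>" "0 \<le> \<Delta>" "0 < nmax" "nmin \<le> nmax"
    and "\<Delta> \<le> \<sigma> * sqrt (real (nmin + nmax)) / (8 * sqrt ((2 + \<epsilon>) * real nmax))"
  shows "\<Delta> < \<sigma>"
    and "8 * (2 + \<epsilon>) * (\<Delta> / (\<sigma> - \<Delta>))\<^sup>2 < 1 + real nmin / real nmax"
    and "8 * (2 + \<epsilon>) * (\<Delta> / (\<sigma> - \<Delta>))\<^sup>2 \<le> 64 * (2 + \<epsilon>) / \<sigma>\<^sup>2 * \<Delta>\<^sup>2"
proof -
  have sq: "(2 + \<epsilon>) * \<Delta>\<^sup>2 \<le> \<sigma>\<^sup>2 / 32"
    using noise_condition_squared[OF assms(2-6)] .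
  moreover have "2 * \<Delta>\<^sup>2 \<le> (2 + \<epsilon>) * \<Delta>\<^sup>2"
    using assms(2) by (simp add: mult_right_mono)
  moreover have "(\<sigma> / 8)\<^sup>2 = \<sigma>\<^sup>2 / 64"
    by (simp add: power_divide)
  ultimately have "\<Delta>\<^sup>2 \<le> (\<sigma> / 8)\<^sup>2"
    by linarith
  then have "\<Delta> \<le> \<sigma> / 8"
    by (rule power2_le_imp_le) (use \<open>0 < \<sigma>\<close> in simp)
  then show "\<Delta> < \<sigma>"
    using \<open>0 < \<sigma>\<close> by simp
  have "8 * (2 + \<epsilon>) * (\<Delta> / (\<sigma> - \<Delta>))\<^sup>2 \<le> 8 * (2 + \<epsilon>) * (\<Delta> / (7 / 8 * \<sigma>))\<^sup>2"
    using \<open>\<Delta> \<le> \<sigma> / 8\<close> \<open>0 < \<sigma>\<close> \<open>0 \<le> \<Delta>\<close> assms(2)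
    by (intro mult_left_mono power_mono divide_left_mono) simp_all
  also have "\<dots> = 512 / 49 * ((2 + \<epsilon>) * \<Delta>\<^sup>2) / \<sigma>\<^sup>2"
    by (simp add: power_divide power_mult_distrib)
  finally have ratio: "8 * (2 + \<epsilon>) * (\<Delta> / (\<sigma> - \<Delta>))\<^sup>2 \<le> 512 / 49 * ((2 + \<epsilon>) * \<Delta>\<^sup>2) / \<sigma>\<^sup>2" .
  also have "\<dots> \<le> 512 / 49 * (\<sigma>\<^sup>2 / 32) / \<sigma>\<^sup>2"
    using sq by (intro divide_right_mono mult_left_mono) simp_all
  also have "\<dots> < 1"
    using \<open>0 < \<sigma>\<close> by simp
  also have "1 \<le> 1 + real nmin / real nmax"
    by simp
  finally show "8 * (2 + \<epsilon>) * (\<Delta> / (\<sigma> - \<Delta>))\<^sup>2 < 1 + real nmin / real nmax" .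
  have "512 / 49 * ((2 + \<epsilon>) * \<Delta>\<^sup>2) / \<sigma>\<^sup>2 \<le> 64 * ((2 + \<epsilon>) * \<Delta>\<^sup>2) / \<sigma>\<^sup>2"
    using assms(2) by (intro divide_right_mono mult_right_mono) simp_all
  also have "\<dots> = 64 * (2 + \<epsilon>) / \<sigma>\<^sup>2 * \<Delta>\<^sup>2"
    by simp
  finally show "8 * (2 + \<epsilon>) * (\<Delta> / (\<sigma> - \<Delta>))\<^sup>2 \<le> 64 * (2 + \<epsilon>) / \<sigma>\<^sup>2 * \<Delta>\<^sup>2"
    using ratio by linarith
qed

theorem lemma7:
  fixes \<Phi>bar \<Phi> U :: "real^'r::finite^'s::finite"
    and \<Omega> \<Omega>h :: "'r \<Rightarrow> 's set" and ch :: "'r \<Rightarrow> real^'r" and \<epsilon> :: real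
  assumes "\<epsilon> \<ge> 0"
    and "is_partition \<Omega>"
    and "\<And>k i i'. i \<in> \<Omega> k \<Longrightarrow> i' \<in> \<Omega> k \<Longrightarrow> \<Phi>bar $ i = \<Phi>bar $ i'"
    and "rank \<Phi>bar = CARD('r)"
    and "top_left_singular_vectors U \<Phi>"
    and "approx_kmeans_solution \<epsilon> U \<Omega>h ch"
    and "frob_norm (\<Phi>bar - \<Phi>) \<le> sigma_r \<Phi>bar * sqrt (real (min_cluster_size \<Omega> + max_cluster_size \<Omega>))
           / (8 * sqrt ((2 + \<epsilon>) * real (max_cluster_size \<Omega>)))"
  shows "misclustering_rate \<Omega> \<Omega>h \<le> 64 * (2 + \<epsilon>) / (sigma_r \<Phi>bar)^2 * (frob_norm (\<Phi>bar - \<Phi>))^2"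
proof -
  let ?\<sigma> = "sigma_r \<Phi>bar" and ?\<Delta> = "frob_norm (\<Phi>bar - \<Phi>)"
  have "0 < max_cluster_size \<Omega>" "min_cluster_size \<Omega> \<le> max_cluster_size \<Omega>"
    using card_cluster_pos[OF assms(2)] card_le_max_cluster_size min_cluster_size_le_card
    by (metis less_le_trans, metis le_trans)
  note noise = noise_condition_bounds[OF sigma_r_lower_bound(1)[OF assms(4)] assms(1)
      frob_norm_nonneg this assms(7)]
  obtain D where UM: "transpose U ** (\<Phi>bar ** D) = mat 1"
    and close: "frob_norm (U - \<Phi>bar ** D) \<le> ?\<Delta> / (?\<sigma> - ?\<Delta>)"
    using singular_vectors_near_row_space[OF top_left_singular_vectors_range[OF assms(5)]
        sigma_r_lower_bound(2)[OF assms(4)] noise(1)] by blast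
  have rows_const: "(\<Phi>bar ** D) $ i = (\<Phi>bar ** D) $ i'" if "i \<in> \<Omega> k" "i' \<in> \<Omega> k" for k i i'
    using assms(3)[OF that] by (simp add: row_matrix_matrix_mult)
  have cost: "8 * (2 + \<epsilon>) * (frob_norm (U - \<Phi>bar ** D))\<^sup>2 \<le> 8 * (2 + \<epsilon>) * (?\<Delta> / (?\<sigma> - ?\<Delta>))\<^sup>2"
    using close assms(1) frob_norm_nonneg by (intro mult_left_mono power_mono) simp_all
  have "misclustering_rate \<Omega> \<Omega>h \<le> 8 * (2 + \<epsilon>) * (frob_norm (U - \<Phi>bar ** D))\<^sup>2"
    using noise(2) cost
    by (intro misclustering_rate_le_kmeans_cost[OF assms(1,2,6) top_left_singular_vectors_range(1)[OF assms(5)]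
        UM rows_const]) simp_all
  also have "\<dots> \<le> 64 * (2 + \<epsilon>) / ?\<sigma>\<^sup>2 * ?\<Delta>\<^sup>2"
    using cost noise(3) by linarith
  finally show ?thesis .
qed

end
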